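(* Let $(V,E,\mu)$ be a measure graph and let $v,w\in V$. Then $$\inf_{A\subseteq V}\mathrm{disc\text{-}SR}_{v,w}(A)=\inf_{A\in\mathrm{disc\text{-}SS}(v,w)}\mu(A).$$
   Context: A graph is a couple $(V,E)$ with $V$ a set of vertices and $E$ a set of unordered pairs of vertices (a subset of $(V\times V)/\mathfrak S_2$, where $\mathfrak S_2$ swaps the two factors). A measure graph $(V,E,\mu)$ is a graph with $V$ countable together with a function $\mu\colon V\to(0,+\infty)$, extended to a measure on $2^V$ by $\mu(A)=\sum_{z\in A}\mu(z)\in[0,+\infty]$. A path is a finite sequence $\{q_i\}_{i=0}^N$ of vertices with $(q_i,q_{i+1})\in E$ for all $i<N$. $\mathcal P_{v,w}$ is the set of paths with $q_0=v$ and $q_N=w$. For a path $\mathsf c$ and $A\subseteq V$, $\mathsf c\cap A$ is the set of vertices of $\mathsf c$ belonging to $A$. The discrete width is $\mathrm{disc\text{-}width}_{v,w}(A)=\inf\{\#(\mathsf c\cap A):\mathsf c\in\mathcal P_{v,w}\}$, equal to $+\infty$ if $\mathcal P_{v,w}=\emptyset$. $\mathrm{disc\text{-}SS}(v,w)$ is the class of sets $A\subseteq V$ with $\mathrm{disc\text{-}width}_{v,w}(A)\ge1$, i.e. such that every path between $v$ and $w$ intersects $A$ (so every subset of $V$, including $\emptyset$, if $\mathcal P_{v,w}=\emptyset$). The discrete separating ratio is $\mathrm{disc\text{-}SR}_{v,w}(A)=\frac{\mu(A)}{\mathrm{disc\text{-}width}_{v,w}(A)}$, with the conventions that it equals $0$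 if $\mathrm{disc\text{-}width}_{v,w}(A)=+\infty$ (i.e. $\mathcal P_{v,w}=\emptyset$), and $+\infty$ if $\mathrm{disc\text{-}width}_{v,w}(A)=0$ (i.e. $A\notin\mathrm{disc\text{-}SS}(v,w)$). *)

theory Defs
  imports "HOL-Analysis.Analysis" "HOL-Library.Uprod"
begin

text \<open>Edges are unordered pairs of vertices, so loops \<open>Upair x x\<close> are allowed.\<close>

definition graph :: "'a set \<Rightarrow> 'a uprod set \<Rightarrow> bool" where
  "graph V E \<longleftrightarrow> E \<subseteq> {Upair x y |x y. x \<in> V \<and> y \<in> V}"

definition measure_graph :: "'a set \<Rightarrow> 'a uprod set \<Rightarrow> ('a \<Rightarrow> real) \<Rightarrow> bool" where
  "measure_graph V E \<mu> \<longleftrightarrow> graph V E \<and> countable V \<and> (\<forall>z\<in>V. 0 < \<mu> z)"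

definition graph_measure :: "('a \<Rightarrow> real) \<Rightarrow> 'a set \<Rightarrow> ennreal" where
  "graph_measure \<mu> A = (\<Sum>\<^sub>\<infinity>z\<in>A. ennreal (\<mu> z))"

text \<open>A path \<open>q\<^sub>0, \<dots>, q\<^sub>N\<close> is a list of length \<open>N + 1\<close>; the one-vertex path \<open>N = 0\<close> is allowed.\<close>

definition paths :: "'a set \<Rightarrow> 'a uprod set \<Rightarrow> 'a \<Rightarrow> 'a \<Rightarrow> 'a list set" where
  "paths V E v w =
    {c. c \<noteq> [] \<and> set c \<subseteq> V \<and> hd c = v \<and> last c = w \<and>
        (\<forall>i. Suc i < length c \<longrightarrow> Upair (c ! i) (c ! Suc i) \<in> E)}"

text \<open>\<open>set c \<inter> A\<close> is a set of vertices: a vertex visited several times counts once.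
  In \<^typ>\<open>enat\<close> the infimum over the empty set of paths is \<open>\<infinity>\<close>.\<close>

definition disc_width :: "'a set \<Rightarrow> 'a uprod set \<Rightarrow> 'a \<Rightarrow> 'a \<Rightarrow> 'a set \<Rightarrow> enat" where
  "disc_width V E v w A = (INF c\<in>paths V E v w. enat (card (set c \<inter> A)))"

definition disc_SS :: "'a set \<Rightarrow> 'a uprod set \<Rightarrow> 'a \<Rightarrow> 'a \<Rightarrow> 'a set set" where
  "disc_SS V E v w = {A. A \<subseteq> V \<and> 1 \<le> disc_width V E v w A}"

definition disc_SR ::
  "'a set \<Rightarrow> 'a uprod set \<Rightarrow> ('a \<Rightarrow> real) \<Rightarrow> 'a \<Rightarrow> 'a \<Rightarrow> 'a set \<Rightarrow> ennreal" where
  "disc_SR V E \<mu> v w A =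
    (if disc_width V E v w A = \<infinity> then 0
     else if disc_width V E v w A = 0 then \<infinity>
     else graph_measure \<mu> A / ennreal_of_enat (disc_width V E v w A))"

end

theory Submission
  imports Defs
begin

text \<open>
  One inequality is immediate: dividing by a width that is at least \<open>1\<close> does not increase
  a measure.  For the other, let \<open>A\<close> have finite width \<open>k \<ge> 1\<close>.  Use
  \<open>d x = disc_width V E v x A\<close> as a distance from \<open>v\<close>: it is the length of a shortest path
  to \<open>x\<close> when only the distinct vertices in \<open>A\<close> are counted.  Slice \<open>A\<close> by this distance into
  \<open>A\<^sub>i = {x \<in> A. d x = i}\<close>.  Since \<open>d\<close> grows by at most one along an edge, and only on entering
  a vertex of \<open>A\<close>, a path from \<open>v\<close> to \<open>w\<close>, at whose end \<open>d\<close> equals \<open>k\<close>, cannot skip any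
  of the values \<open>1, \<dots>, k\<close>, and attains each of them for the first time at a vertex of \<open>A\<close>
  (lemma \<open>path_meets_width_level\<close>).  Thus \<open>A\<^sub>1, \<dots>, A\<^sub>k\<close> are \<open>k\<close> pairwise disjoint separating
  subsets of \<open>A\<close>; each has measure at least the infimum \<open>m\<close> over separating sets, so
  \<open>k * m \<le> \<mu>(A)\<close>, which is \<open>m \<le> \<mu>(A) / k\<close>.
\<close>

lemma paths_singleton: "v \<in> V \<Longrightarrow> [v] \<in> paths V E v v"
  by (simp add: paths_def)

lemma paths_snoc:
  assumes "c \<in> paths V E v x" and "y \<in> V" and "Upair x y \<in> E"
  shows "c @ [y] \<in> paths V E v y"
proof -
  have "Upair ((c @ [y]) ! i) ((c @ [y]) ! Suc i) \<in> E" if "Suc i < length (c @ [y])" for i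
  proof (cases "Suc i < length c")
    case True
    with assms show ?thesis by (auto simp: paths_def nth_append)
  next
    case False
    with that have "i = length c - 1" and "c \<noteq> []" and "Suc i = length c" by auto
    with assms show ?thesis by (auto simp: paths_def nth_append last_conv_nth)
  qed
  with assms show ?thesis by (auto simp: paths_def)
qed

lemma paths_snocD:
  assumes "c @ [y] \<in> paths V E v z" and "c \<noteq> []"
  shows "y = z" and "y \<in> V" and "c \<in> paths V E v (last c)" and "Upair (last c) y \<in> E"
proof -
  have edge: "Upair ((c @ [y]) ! i) ((c @ [y]) ! Suc i) \<in> E" if "Suc i < length (c @ [y])" for i
    using assms that by (auto simp: paths_def)
  have "Upair (c ! i) (c ! Suc i) \<in> E" if "Suc i < length c" for i
    using edge[of i] that by (simp add: nth_append)
  with assms show "c \<in> paths V E v (last c)" by (auto simp: paths_def)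
  show "Upair (last c) y \<in> E"
    using edge[of "length c - 1"] \<open>c \<noteq> []\<close> by (auto simp: nth_append last_conv_nth)
qed (use assms in \<open>auto simp: paths_def\<close>)

lemma disc_width_le: "c \<in> paths V E v w \<Longrightarrow> disc_width V E v w A \<le> enat (card (set c \<inter> A))"
  unfolding disc_width_def by (rule INF_lower)

lemma disc_width_attained:
  assumes "paths V E v w \<noteq> {}"
  obtains c where "c \<in> paths V E v w" and "disc_width V E v w A = enat (card (set c \<inter> A))"
proof -
  obtain c where "c \<in> paths V E v w" using assms by blast
  then have "disc_width V E v w A \<in> (\<lambda>c. enat (card (set c \<inter> A))) ` paths V E v w"
    unfolding disc_width_def by (intro wellorder_InfI[OF imageI])
  then show ?thesis using that by auto
qed

lemma disc_width_eq_infinity_iff: "disc_width V E v w A = \<infinity> \<longleftrightarrow> paths V E v w = {}"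
proof
  assume "disc_width V E v w A = \<infinity>"
  then show "paths V E v w = {}" by (metis disc_width_attained enat.distinct(2))
qed (simp add: disc_width_def top_enat_def)

lemma one_le_disc_width_iff:
  "1 \<le> disc_width V E v w A \<longleftrightarrow> (\<forall>c\<in>paths V E v w. set c \<inter> A \<noteq> {})"
  by (auto simp: disc_width_def le_INF_iff one_enat_def Suc_le_eq card_gt_0_iff)

lemma disc_width_self_le:
  assumes "v \<in> V"
  shows "disc_width V E v v A \<le> (if v \<in> A then 1 else 0)"
  using disc_width_le[OF paths_singleton[OF assms], of E A] by (auto simp: one_enat_def zero_enat_def)

text \<open>Extending an optimal path to \<open>x\<close> by \<open>y\<close> adds at most the one vertex \<open>y\<close> to its
  intersection with \<open>A\<close>.\<close>

lemma disc_width_step: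
  assumes "paths V E v x \<noteq> {}" and "y \<in> V" and "Upair x y \<in> E"
  shows "disc_width V E v y A \<le> disc_width V E v x A + (if y \<in> A then 1 else 0)"
proof -
  obtain c where c: "c \<in> paths V E v x" and w: "disc_width V E v x A = enat (card (set c \<inter> A))"
    using disc_width_attained[OF assms(1)] .
  have "disc_width V E v y A \<le> enat (card (set (c @ [y]) \<inter> A))"
    by (rule disc_width_le[OF paths_snoc[OF c assms(2,3)]])
  also have "\<dots> \<le> enat (card (set c \<inter> A) + (if y \<in> A then 1 else 0))"
    by (auto simp: card_insert_if)
  finally show ?thesis by (simp add: w one_enat_def zero_enat_def split: if_splits)
qed

definition width_level :: "'a set \<Rightarrow> 'a uprod set \<Rightarrow> 'a \<Rightarrow> 'a set \<Rightarrow> nat \<Rightarrow> 'a set" where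
  "width_level V E v A i = {x \<in> A. disc_width V E v x A = enat i}"

text \<open>A discrete intermediate value property.  At the first vertex where the width from \<open>v\<close>
  reaches \<open>i\<close> it has just increased; as it increases by at most one, and only at vertices
  of \<open>A\<close>, its value there is exactly \<open>i\<close> and the vertex lies in \<open>A\<close>.\<close>

lemma path_meets_width_level:
  assumes "c \<in> paths V E v x" and "1 \<le> i" and "enat i \<le> disc_width V E v x A"
  shows "set c \<inter> width_level V E v A i \<noteq> {}"
  using assms(1,3)
proof (induction c arbitrary: x rule: rev_induct)
  case Nil
  then show ?case by (simp add: paths_def)
next
  case (snoc y c)
  show ?case
  proof (cases "c = []")
    case True
    with snoc.prems have "y = v" "x = v" "v \<in> V" by (auto simp: paths_def)
    have "enat i \<le> disc_width V E v v A" using snoc.prems(2) \<open>x = v\<close> by simp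
    also have le: "disc_width V E v v A \<le> (if v \<in> A then 1 else 0)"
      by (rule disc_width_self_le[OF \<open>v \<in> V\<close>])
    finally have "v \<in> A" "i = 1"
      using \<open>1 \<le> i\<close> by (auto simp: one_enat_def zero_enat_def split: if_splits)
    with le snoc.prems(2) \<open>x = v\<close> have "v \<in> width_level V E v A i"
      by (auto simp: width_level_def one_enat_def)
    with \<open>y = v\<close> show ?thesis by auto
  next
    case False
    note * = paths_snocD[OF snoc.prems(1) this]
    show ?thesis
    proof (cases "enat i \<le> disc_width V E v (last c) A")
      case True
      with snoc.IH[OF *(3)] show ?thesis by auto
    next
      case lt: False
      have step: "disc_width V E v y A \<le> disc_width V E v (last c) A + (if y \<in> A then 1 else 0)"
        using *(2,3,4) by (intro disc_width_step) auto
      obtain n where n: "disc_width V E v (last c) A = enat n" "n < i"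
        using lt by (cases "disc_width V E v (last c) A") auto
      obtain m where m: "disc_width V E v y A = enat m"
        using step n by (cases "disc_width V E v y A") (auto simp: one_enat_def split: if_splits)
      have "y \<in> A" "m = i"
        using step n m snoc.prems(2) *(1)
        by (auto simp: one_enat_def zero_enat_def split: if_splits)
      with m show ?thesis by (auto simp: width_level_def)
    qed
  qed
qed

lemma width_level_in_disc_SS:
  assumes "A \<subseteq> V" and "1 \<le> i" and "enat i \<le> disc_width V E v w A"
  shows "width_level V E v A i \<in> disc_SS V E v w"
  using assms path_meets_width_level[OF _ assms(2,3)]
  by (auto simp: disc_SS_def one_le_disc_width_iff width_level_def)

lemma graph_measure_mono: "A \<subseteq> B \<Longrightarrow> graph_measure \<mu> A \<le> graph_measure \<mu> B"
  unfolding graph_measure_def by (rule infsum_mono_neutral) (auto intro: nonneg_summable_on_complete)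

lemma graph_measure_UN_disjoint:
  assumes "finite I" and "disjoint_family_on F I"
  shows "graph_measure \<mu> (\<Union>i\<in>I. F i) = (\<Sum>i\<in>I. graph_measure \<mu> (F i))"
  using assms
proof (induction I rule: finite_induct)
  case empty
  then show ?case by (simp add: graph_measure_def)
next
  case (insert i I)
  have "F i \<inter> (\<Union>j\<in>I. F j) = {}"
    using insert.prems insert.hyps by (auto simp: disjoint_family_on_def)
  then have "graph_measure \<mu> (F i \<union> (\<Union>j\<in>I. F j))
      = graph_measure \<mu> (F i) + graph_measure \<mu> (\<Union>j\<in>I. F j)"
    unfolding graph_measure_def
    by (intro infsum_Un_disjoint nonneg_summable_on_complete) auto
  moreover have "disjoint_family_on F I"
    using insert.prems by (auto simp: disjoint_family_on_def)
  ultimately show ?case using insert by simp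
qed

text \<open>The levels \<open>1, \<dots>, k\<close> are disjoint subsets of \<open>A\<close>, and each of them separates.\<close>

lemma width_mult_INF_le_graph_measure:
  assumes "A \<subseteq> V" and "disc_width V E v w A = enat k"
  shows "of_nat k * (INF B\<in>disc_SS V E v w. graph_measure \<mu> B) \<le> graph_measure \<mu> A"
proof -
  let ?L = "width_level V E v A"
  have "of_nat k * (INF B\<in>disc_SS V E v w. graph_measure \<mu> B)
      = (\<Sum>i\<in>{1..k}. INF B\<in>disc_SS V E v w. graph_measure \<mu> B)"
    by simp
  also have "\<dots> \<le> (\<Sum>i\<in>{1..k}. graph_measure \<mu> (?L i))"
    using assms by (intro sum_mono INF_lower width_level_in_disc_SS) auto
  also have "\<dots> = graph_measure \<mu> (\<Union>i\<in>{1..k}. ?L i)"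
    by (rule graph_measure_UN_disjoint[symmetric])
      (auto simp: disjoint_family_on_def width_level_def)
  also have "\<dots> \<le> graph_measure \<mu> A"
    by (rule graph_measure_mono) (auto simp: width_level_def)
  finally show ?thesis .
qed

lemma le_divide_of_nat_ennreal:
  fixes a b :: ennreal
  assumes "of_nat k * a \<le> b" and "0 < k"
  shows "a \<le> b / of_nat k"
proof -
  have "a = of_nat k * a / of_nat k"
    using \<open>0 < k\<close> by (simp add: ennreal_mult_divide_eq mult.commute)
  also have "\<dots> \<le> b / of_nat k"
    by (rule divide_right_mono_ennreal[OF assms(1)])
  finally show ?thesis .
qed

lemma INF_disc_SS_le_disc_SR:
  assumes "A \<subseteq> V"
  shows "(INF B\<in>disc_SS V E v w. graph_measure \<mu> B) \<le> disc_SR V E \<mu> v w A"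
proof (cases "disc_width V E v w A")
  case infinity
  \<comment> \<open>Without any path from \<open>v\<close> to \<open>w\<close>, the empty set separates.\<close>
  then have "{} \<in> disc_SS V E v w"
    by (auto simp: disc_width_eq_infinity_iff disc_SS_def one_le_disc_width_iff)
  then have "(INF B\<in>disc_SS V E v w. graph_measure \<mu> B) \<le> graph_measure \<mu> {}"
    by (rule INF_lower)
  then show ?thesis using infinity by (simp add: disc_SR_def graph_measure_def)
next
  case (enat k)
  show ?thesis
  proof (cases "k = 0")
    case True
    with enat show ?thesis by (simp add: disc_SR_def zero_enat_def)
  next
    case False
    with le_divide_of_nat_ennreal[OF width_mult_INF_le_graph_measure[OF assms enat]] enat
    show ?thesis by (simp add: disc_SR_def zero_enat_def)
  qed
qed

lemma disc_SR_le_graph_measure: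
  assumes "A \<in> disc_SS V E v w"
  shows "disc_SR V E \<mu> v w A \<le> graph_measure \<mu> A"
proof (cases "disc_width V E v w A")
  case infinity
  then show ?thesis by (simp add: disc_SR_def)
next
  case (enat k)
  with assms have "1 \<le> k" by (auto simp: disc_SS_def one_enat_def)
  then have "(1::ennreal) \<le> of_nat k"
    by (metis of_nat_1 of_nat_mono)
  then have "1 * graph_measure \<mu> A \<le> of_nat k * graph_measure \<mu> A"
    by (intro mult_right_mono) auto
  then have "graph_measure \<mu> A / of_nat k \<le> graph_measure \<mu> A"
    using \<open>1 \<le> k\<close> by (intro divide_le_posI_ennreal) auto
  with enat \<open>1 \<le> k\<close> show ?thesis by (simp add: disc_SR_def zero_enat_def)
qed

theorem theorem6p5:
  fixes V :: "'a set" and E :: "'a uprod set" and \<mu> :: "'a \<Rightarrow> real" and v w :: 'a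
  assumes "measure_graph V E \<mu>" and "v \<in> V" and "w \<in> V"
  shows "(INF A\<in>Pow V. disc_SR V E \<mu> v w A) = (INF A\<in>disc_SS V E v w. graph_measure \<mu> A)"
proof (rule antisym)
  show "(INF A\<in>Pow V. disc_SR V E \<mu> v w A) \<le> (INF A\<in>disc_SS V E v w. graph_measure \<mu> A)"
  proof (rule INF_mono)
    fix A
    assume A: "A \<in> disc_SS V E v w"
    then have "A \<in> Pow V" by (simp add: disc_SS_def)
    with disc_SR_le_graph_measure[OF A]
    show "\<exists>B\<in>Pow V. disc_SR V E \<mu> v w B \<le> graph_measure \<mu> A" by blast
  qed
  show "(INF A\<in>disc_SS V E v w. graph_measure \<mu> A) \<le> (INF A\<in>Pow V. disc_SR V E \<mu> v w A)"
    by (intro INF_greatest INF_disc_SS_le_disc_SR) simp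
qed

end
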